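(* Let $n,k$ be integers with $0<k<n$, let $\bar a\in\mathbb{R}$, $\bar x\in\mathbb{R}^n$, $\bar d\in\mathbb{R}^n$, and let $(a^*,x^*,d^* )$ be the unique optimal solution of $$\min_{a\in\mathbb{R},\ x\in\mathbb{R}^n,\ d\in\mathbb{R}^n}\left\{\tfrac12(a-\bar a)^2+\|x-\bar x\|^2+\tfrac12\|d-\bar d\|^2\ :\ \begin{bmatrix}ka&x^\top \\ x&\operatorname{Diag}(d)\end{bmatrix}\succeq0\right\}.$$ For any $\lambda>0$ and $i\in\{1,\dots,n\}$ consider $$d_i(\lambda):=\operatorname*{arg\,min}_{d_i\ge0}\left\{\tfrac12(d_i-\bar d_i)^2+\frac{\lambda\bar x_i^2}{d_i+\lambda}\right\}.$$ Then $d_i(\lambda)=0$ if $\bar d_i+\bar x_i^2/\lambda\le0$; otherwise $d_i(\lambda)>0$ is the unique (positive) solution of $$(d_i-\bar d_i)(d_i+\lambda)^2=\lambda\bar x_i^2.$$ Moreover, one of the following two cases holds: (i) If $\sum_{i=1}^n\bar x_i^2/(\bar d_i)_+\le k\,\bar a_+$, then $(a^*,x^*,d^* )=(\bar a_+,\bar x,\bar d_+)$. (ii) Otherwise, there exists a multiplier $\lambda^*>0$ such that $$a^*=(\bar a+k\lambda^* )_+,\qquad x_i^*=\frac{d_i^*}{d_i^*+\lambda^*}\,\bar x_i,\quad i\in\{1,\dots,n\},$$ where $d_i^*=d_i(\lambda^* )$. Such a multiplier $\lambda^*$ satisfies the scalar equation $$\sum_{i=1}^n\frac{\bar x_i^2\,d_i(\lambda^*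 )}{(d_i(\lambda^* )+\lambda^* )^2}=k(\bar a+k\lambda^* )_+.$$
   Context: $\operatorname{Diag}(d)$ is the diagonal matrix with diagonal $d$; $(\cdot)_+$ denotes the (entrywise) positive part; $\|\cdot\|$ is the Euclidean norm. For nonnegative scalars $s,t$, the quotient $s/t$ is extended-real: $s/0:=0$ if $s=0$ and $s/0:=+\infty$ if $s>0$. *)

theory Defs
  imports "HOL-Analysis.Analysis"
begin

definition psd :: "real^'m^'m \<Rightarrow> bool" where
  "psd A \<longleftrightarrow> transpose A = A \<and> (\<forall>v. 0 \<le> v \<bullet> (A *v v))"

definition diag_mat :: "real^'n \<Rightarrow> real^'n^'n" where
  "diag_mat d = (\<chi> i j. if i = j then d $ i else 0)"

text \<open>The bordered matrix with scalar corner \<open>c\<close>, border \<open>x\<close> and lower right block \<open>B\<close>.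
  Rows and columns are indexed by \<^typ>\<open>'n option\<close>, where \<^const>\<open>None\<close> is the extra
  (first) index, so the size is \<open>CARD('n) + 1\<close>.\<close>

definition bordered_mat :: "real \<Rightarrow> real^'n \<Rightarrow> real^'n^'n \<Rightarrow> real^('n option)^('n option)" where
  "bordered_mat c x B = (\<chi> p q.
     case p of
       None \<Rightarrow> (case q of None \<Rightarrow> c | Some j \<Rightarrow> x $ j)
     | Some i \<Rightarrow> (case q of None \<Rightarrow> x $ i | Some j \<Rightarrow> B $ i $ j))"

definition feasible :: "nat \<Rightarrow> real \<times> (real^'n) \<times> (real^'n) \<Rightarrow> bool" where
  "feasible k = (\<lambda>(a, x, d). psd (bordered_mat (real k * a) x (diag_mat d)))"

definition objective ::
  "real \<Rightarrow> real^'n \<Rightarrow> real^'n \<Rightarrow> real \<times> (real^'n) \<times> (real^'n) \<Rightarrow> real" where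
  "objective abar xbar dbar = (\<lambda>(a, x, d).
     1/2 * (a - abar)\<^sup>2 + (norm (x - xbar))\<^sup>2 + 1/2 * (norm (d - dbar))\<^sup>2)"

definition optimal ::
  "nat \<Rightarrow> real \<Rightarrow> real^'n \<Rightarrow> real^'n \<Rightarrow> real \<times> (real^'n) \<times> (real^'n) \<Rightarrow> bool" where
  "optimal k abar xbar dbar = is_arg_min (objective abar xbar dbar) (feasible k)"

definition coord_objective :: "real \<Rightarrow> real \<Rightarrow> real \<Rightarrow> real \<Rightarrow> real" where
  "coord_objective xi di lam t = 1/2 * (t - di)\<^sup>2 + lam * xi\<^sup>2 / (t + lam)"

text \<open>\<^const>\<open>arg_min\<close> selects some minimizer, if there is one; that the minimizer exists and
  is unique for \<open>lam > 0\<close> is part of the theorem.\<close>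

definition coord_argmin :: "real^'n \<Rightarrow> real^'n \<Rightarrow> real \<Rightarrow> 'n \<Rightarrow> real" where
  "coord_argmin xbar dbar lam i =
     arg_min (coord_objective (xbar $ i) (dbar $ i) lam) (\<lambda>t. 0 \<le> t)"

definition pos_part :: "real \<Rightarrow> real" where
  "pos_part t = max 0 t"

definition pos_part_vec :: "real^'n \<Rightarrow> real^'n" where
  "pos_part_vec v = (\<chi> i. pos_part (v $ i))"

text \<open>The extended-real quotient of nonnegative scalars is the library division on
  \<^typ>\<open>ereal\<close>, where \<open>1 / 0 = \<infinity>\<close> and \<open>0 * \<infinity> = 0\<close>.\<close>

lemma ereal_quotient_by_zero:
  fixes s :: real
  assumes "0 \<le> s"
  shows "ereal s / ereal 0 = (if s = 0 then 0 else \<infinity>)"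
  using assms by (auto simp: divide_ereal_def zero_ereal_def[symmetric])

definition ratio_sum :: "real^'n \<Rightarrow> real^'n \<Rightarrow> ereal" where
  "ratio_sum xbar dbar = (\<Sum>i\<in>UNIV. ereal ((xbar $ i)\<^sup>2) / ereal (pos_part (dbar $ i)))"

definition is_multiplier ::
  "nat \<Rightarrow> real \<Rightarrow> real^'n \<Rightarrow> real^'n \<Rightarrow> real \<times> (real^'n) \<times> (real^'n) \<Rightarrow> real \<Rightarrow> bool" where
  "is_multiplier k abar xbar dbar = (\<lambda>(a, x, d) lam.
     0 < lam \<and>
     a = pos_part (abar + real k * lam) \<and>
     (\<forall>i. d $ i = coord_argmin xbar dbar lam i) \<and>
     (\<forall>i. x $ i = d $ i / (d $ i + lam) * xbar $ i))"

end

theory Submission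
  imports Defs
begin

text \<open>The scalar minimizer is the unique fixed point of the decreasing map
  \<open>t \<mapsto> (d + lam x\<^sup>2 / (t + lam)\<^sup>2)\<^sub>+\<close>, and so depends continuously on \<open>lam\<close>. The scalar
  equation for the multiplier is solved by the intermediate value theorem: its left-hand side
  tends to the ratio sum as \<open>lam \<rightarrow> 0\<close> and to \<open>0\<close> as \<open>lam \<rightarrow> \<infinity>\<close>. A solution is a certificate of
  optimality. Since the Lagrangian is strongly convex, the optimal point is unique. Any other
  multiplier of that point is the same one unless \<open>a = 0\<close>, and then feasibility forces \<open>x = 0\<close>,
  so that both sides of the equation vanish.\<close>

section \<open>Positive semidefiniteness of the bordered matrix\<close>

lemma sum_UNIV_option:
  "(\<Sum>p\<in>(UNIV :: 'n::finite option set). f p) = f None + (\<Sum>i\<in>UNIV. f (Some i))"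
proof -
  have "(\<Sum>p\<in>range Some. f p) = (\<Sum>i\<in>(UNIV :: 'n set). f (Some i))"
    by (subst sum.reindex) auto
  then show ?thesis
    by (simp add: UNIV_option_conv)
qed

lemma bordered_diag_quadratic_form:
  "v \<bullet> (bordered_mat c x (diag_mat d) *v v) =
    c * (v $ None)\<^sup>2 + 2 * v $ None * (\<Sum>i\<in>UNIV. x $ i * v $ Some i)
      + (\<Sum>i\<in>UNIV. d $ i * (v $ Some i)\<^sup>2)"
proof -
  have *: "(\<Sum>j\<in>UNIV. v $ Some i * (v $ Some j * (if i = j then d $ i else 0)))
      = d $ i * (v $ Some i * v $ Some i)" for i
    by (simp add: if_distrib cong: if_cong)
  show ?thesis
    by (simp add: inner_vec_def matrix_vector_mult_def sum_UNIV_option bordered_mat_def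
        diag_mat_def * algebra_simps power2_eq_square sum.distrib sum_distrib_left)
qed

text \<open>Symmetry is automatic, so only the quadratic form remains. A vector over
  \<open>'n option\<close> is split into its \<open>None\<close> entry \<open>t\<close> and the
  remaining entries \<open>u\<close>.\<close>

lemma psd_bordered_diag_iff:
  "psd (bordered_mat c x (diag_mat d)) \<longleftrightarrow>
    (\<forall>t u. 0 \<le> c * t\<^sup>2 + 2 * t * (\<Sum>i\<in>UNIV. x $ i * u $ i) + (\<Sum>i\<in>UNIV. d $ i * (u $ i)\<^sup>2))"
    (is "_ \<longleftrightarrow> (\<forall>t u. 0 \<le> ?q t u)")
proof -
  have sym: "transpose (bordered_mat c x (diag_mat d)) = bordered_mat c x (diag_mat d)"
    by (auto simp: transpose_def bordered_mat_def diag_mat_def vec_eq_iff split: option.splits)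
  have "(\<forall>v. 0 \<le> v \<bullet> (bordered_mat c x (diag_mat d) *v v)) \<longleftrightarrow> (\<forall>t u. 0 \<le> ?q t u)"
  proof (intro iffI allI)
    fix t u
    assume "\<forall>v. 0 \<le> v \<bullet> (bordered_mat c x (diag_mat d) *v v)"
    from this[rule_format, of "\<chi> p. case p of None \<Rightarrow> t | Some i \<Rightarrow> u $ i"]
    show "0 \<le> ?q t u"
      by (simp add: bordered_diag_quadratic_form)
  next
    fix v
    assume "\<forall>t u. 0 \<le> ?q t u"
    from this[rule_format, of "v $ None" "\<chi> i. v $ Some i"]
    show "0 \<le> v \<bullet> (bordered_mat c x (diag_mat d) *v v)"
      by (simp add: bordered_diag_quadratic_form)
  qed
  then show ?thesis
    by (simp add: psd_def sym)
qed

lemma psd_bordered_diag_nonneg: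
  assumes "psd (bordered_mat c x (diag_mat d))"
  shows "0 \<le> c" "0 \<le> d $ i"
proof -
  note q = assms[unfolded psd_bordered_diag_iff, rule_format]
  show "0 \<le> c"
    using q[of 1 0] by simp
  have "(\<Sum>j\<in>UNIV. d $ j * (axis i 1 $ j)\<^sup>2) = d $ i"
    by (simp add: axis_def if_distrib[of "\<lambda>y. y\<^sup>2"] if_distrib[of "(*) _"] cong: if_cong)
  then show "0 \<le> d $ i"
    using q[of 0 "axis i 1"] by simp
qed

text \<open>Completing the square. Writing the border as \<open>d * w\<close> replaces the Schur
  complement condition and its division by \<open>d\<close>, so vanishing diagonal entries need no
  separate treatment.\<close>

lemma psd_bordered_diagI:
  assumes d: "\<And>i. 0 \<le> d $ i"
    and x: "\<And>i. x $ i = d $ i * w $ i"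
    and c: "(\<Sum>i\<in>UNIV. d $ i * (w $ i)\<^sup>2) \<le> c"
  shows "psd (bordered_mat c x (diag_mat d))"
  unfolding psd_bordered_diag_iff
proof (intro allI)
  fix t and u :: "real^'a"
  have "c * t\<^sup>2 + 2 * t * (\<Sum>i\<in>UNIV. x $ i * u $ i) + (\<Sum>i\<in>UNIV. d $ i * (u $ i)\<^sup>2)
      = (c - (\<Sum>i\<in>UNIV. d $ i * (w $ i)\<^sup>2)) * t\<^sup>2 + (\<Sum>i\<in>UNIV. d $ i * (u $ i + t * w $ i)\<^sup>2)"
    by (simp add: x power2_eq_square algebra_simps sum.distrib sum_distrib_left)
  also have "\<dots> \<ge> 0"
    using c d by (intro add_nonneg_nonneg sum_nonneg mult_nonneg_nonneg) auto
  finally show "0 \<le> c * t\<^sup>2 + 2 * t * (\<Sum>i\<in>UNIV. x $ i * u $ i) + (\<Sum>i\<in>UNIV. d $ i * (u $ i)\<^sup>2)" .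
qed

section \<open>Optimality certificates from the Lagrangian\<close>

text \<open>The variational inequality of the projection onto the half-line. The term in
  \<open>s - t\<close> records strong convexity and later yields uniqueness.\<close>

lemma pos_part_projection:
  assumes "0 \<le> s" "t = pos_part (c + g)"
  shows "1/2 * (t - c)\<^sup>2 - g * t + 1/2 * (s - t)\<^sup>2 \<le> 1/2 * (s - c)\<^sup>2 - g * s"
proof -
  have "0 \<le> (s - t) * (t - c - g)"
    using assms by (auto simp: pos_part_def max_def)
  then show ?thesis
    by (simp add: power2_eq_square field_simps)
qed

text \<open>Testing positive semidefiniteness at the vector \<open>(1, -w)\<close> gives a linear constraint on
  the feasible points, hence a Lagrangian that separates and needs no division by \<open>d\<close>.\<close>

lemma certificate_objective_bound:
  fixes xbar dbar x d x' d' w :: "real^'n"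
  assumes lam: "0 \<le> lam"
    and a: "a = pos_part (abar + real k * lam)"
    and x: "\<And>i. x $ i = xbar $ i - lam * w $ i"
    and d: "\<And>i. d $ i = pos_part (dbar $ i + lam * (w $ i)\<^sup>2)"
    and slack: "lam * (real k * a - 2 * (\<Sum>i\<in>UNIV. x $ i * w $ i) + (\<Sum>i\<in>UNIV. d $ i * (w $ i)\<^sup>2)) = 0"
    and k: "0 < k"
    and feas: "feasible k (a', x', d')"
  shows "objective abar xbar dbar (a, x, d)
      + (1/2 * (a' - a)\<^sup>2 + (norm (x' - x))\<^sup>2 + 1/2 * (norm (d' - d))\<^sup>2)
    \<le> objective abar xbar dbar (a', x', d')"
proof -
  have psd: "psd (bordered_mat (real k * a') x' (diag_mat d'))"
    using feas by (simp add: feasible_def)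
  have a': "0 \<le> a'"
    using psd_bordered_diag_nonneg(1)[OF psd] k by (simp add: zero_le_mult_iff)
  have d': "0 \<le> d' $ i" for i
    using psd_bordered_diag_nonneg(2)[OF psd] .
  have lin: "0 \<le> real k * a' - 2 * (\<Sum>i\<in>UNIV. x' $ i * w $ i) + (\<Sum>i\<in>UNIV. d' $ i * (w $ i)\<^sup>2)"
    using psd[unfolded psd_bordered_diag_iff, rule_format, of 1 "- w"] by (simp add: sum_negf)
  have norm_sq: "(norm y)\<^sup>2 = (\<Sum>i\<in>UNIV. (y $ i)\<^sup>2)" for y :: "real^'n"
    by (simp add: norm_vec_def L2_set_def sum_nonneg)
  have A: "1/2 * (a - abar)\<^sup>2 - real k * lam * a + 1/2 * (a' - a)\<^sup>2
      \<le> 1/2 * (a' - abar)\<^sup>2 - real k * lam * a'"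
    using pos_part_projection[OF a' a] .
  \<comment> \<open>An equality, because \<open>x\<close> is unconstrained here:
    \<open>xbar - lam * w\<close> is the stationary point of this quadratic.\<close>
  have X: "(norm (x - xbar))\<^sup>2 + 2 * lam * (\<Sum>i\<in>UNIV. x $ i * w $ i) + (norm (x' - x))\<^sup>2
      = (norm (x' - xbar))\<^sup>2 + 2 * lam * (\<Sum>i\<in>UNIV. x' $ i * w $ i)"
    unfolding norm_sq sum_distrib_left sum.distrib[symmetric]
    by (intro sum.cong) (simp_all add: x power2_eq_square algebra_simps)
  have D: "1/2 * (norm (d - dbar))\<^sup>2 - lam * (\<Sum>i\<in>UNIV. d $ i * (w $ i)\<^sup>2) + 1/2 * (norm (d' - d))\<^sup>2
      \<le> 1/2 * (norm (d' - dbar))\<^sup>2 - lam * (\<Sum>i\<in>UNIV. d' $ i * (w $ i)\<^sup>2)"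
    unfolding norm_sq sum_distrib_left sum.distrib[symmetric] sum_subtractf[symmetric]
  proof (rule sum_mono)
    fix i
    show "1/2 * ((d - dbar) $ i)\<^sup>2 - lam * (d $ i * (w $ i)\<^sup>2) + 1/2 * ((d' - d) $ i)\<^sup>2
        \<le> 1/2 * ((d' - dbar) $ i)\<^sup>2 - lam * (d' $ i * (w $ i)\<^sup>2)"
      using pos_part_projection[OF d' d, of i i] by (simp add: mult.assoc mult.left_commute mult.commute)
  qed
  \<comment> \<open>The sum of \<open>A\<close>, \<open>X\<close> and \<open>D\<close> compares
    Lagrangians. The multiplier term is nonnegative at the competitor and vanishes at the candidate
    by \<open>slack\<close>.\<close>
  have "0 \<le> lam * (real k * a' - 2 * (\<Sum>i\<in>UNIV. x' $ i * w $ i) + (\<Sum>i\<in>UNIV. d' $ i * (w $ i)\<^sup>2))"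
    using lam lin by simp
  then show ?thesis
    using A X D slack by (simp add: objective_def algebra_simps)
qed

text \<open>The quadratic gap in the bound serves twice: it is nonnegative, which gives optimality,
  and it is zero only at the candidate, which gives uniqueness.\<close>

lemma certificate_optimal:
  fixes xbar dbar x d w :: "real^'n"
  assumes "0 \<le> lam" "a = pos_part (abar + real k * lam)"
    and "\<And>i. x $ i = xbar $ i - lam * w $ i"
    and "\<And>i. d $ i = pos_part (dbar $ i + lam * (w $ i)\<^sup>2)"
    and "lam * (real k * a - 2 * (\<Sum>i\<in>UNIV. x $ i * w $ i) + (\<Sum>i\<in>UNIV. d $ i * (w $ i)\<^sup>2)) = 0"
    and "0 < k" and feas: "feasible k (a, x, d)"
  shows "optimal k abar xbar dbar z \<longleftrightarrow> z = (a, x, d)"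
proof -
  note bound = certificate_objective_bound[OF assms(1-6)]
  have opt: "optimal k abar xbar dbar (a, x, d)"
    unfolding optimal_def is_arg_min_linorder
  proof (intro conjI feas allI impI)
    fix z' :: "real \<times> (real^'n) \<times> (real^'n)"
    assume "feasible k z'"
    moreover obtain a' x' d' where "z' = (a', x', d')"
      by (cases z')
    ultimately have "objective abar xbar dbar (a, x, d)
      + (1/2 * (a' - a)\<^sup>2 + (norm (x' - x))\<^sup>2 + 1/2 * (norm (d' - d))\<^sup>2)
        \<le> objective abar xbar dbar z'"
      using bound by simp
    moreover have "0 \<le> 1/2 * (a' - a)\<^sup>2 + (norm (x' - x))\<^sup>2 + 1/2 * (norm (d' - d))\<^sup>2"
      by simp
    ultimately show "objective abar xbar dbar (a, x, d) \<le> objective abar xbar dbar z'"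
      by linarith
  qed
  have "z = (a, x, d)" if z: "optimal k abar xbar dbar z"
  proof -
    obtain a' x' d' where z_eq: "z = (a', x', d')"
      by (cases z)
    have feas': "feasible k (a', x', d')"
      and "objective abar xbar dbar (a', x', d') \<le> objective abar xbar dbar (a, x, d)"
      using z feas by (simp_all add: optimal_def is_arg_min_linorder z_eq)
    with bound[OF feas']
    have "1/2 * (a' - a)\<^sup>2 + (norm (x' - x))\<^sup>2 + 1/2 * (norm (d' - d))\<^sup>2 \<le> 0"
      by linarith
    moreover have "0 \<le> (a' - a)\<^sup>2" "0 \<le> (norm (x' - x))\<^sup>2" "0 \<le> (norm (d' - d))\<^sup>2"
      by simp_all
    ultimately have "(a' - a)\<^sup>2 = 0" "(norm (x' - x))\<^sup>2 = 0" "(norm (d' - d))\<^sup>2 = 0"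
      by linarith+
    then show ?thesis
      by (simp add: z_eq)
  qed
  with opt show ?thesis
    by blast
qed

section \<open>The scalar minimizer as a fixed point\<close>

definition scalar_argmin :: "real \<Rightarrow> real \<Rightarrow> real \<Rightarrow> real" where
  "scalar_argmin x d lam = arg_min (coord_objective x d lam) (\<lambda>t. 0 \<le> t)"

text \<open>Its nonnegative fixed points are the solutions of the first-order condition for
  \<open>coord_objective\<close> on the half-line.\<close>

definition prox_step :: "real \<Rightarrow> real \<Rightarrow> real \<Rightarrow> real \<Rightarrow> real" where
  "prox_step x d lam t = pos_part (d + lam * x\<^sup>2 / (t + lam)\<^sup>2)"

lemma pos_part_mono: "s \<le> t \<Longrightarrow> pos_part s \<le> pos_part t"
  by (simp add: pos_part_def)

lemma prox_step_nonneg: "0 \<le> prox_step x d lam t"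
  by (simp add: prox_step_def pos_part_def)

lemma prox_step_antimono:
  assumes "0 < lam" "0 \<le> s" "s \<le> t"
  shows "prox_step x d lam t \<le> prox_step x d lam s"
proof -
  have "lam * x\<^sup>2 / (t + lam)\<^sup>2 \<le> lam * x\<^sup>2 / (s + lam)\<^sup>2"
    using assms by (intro divide_left_mono power_mono mult_pos_pos) auto
  then show ?thesis
    unfolding prox_step_def by (intro pos_part_mono) auto
qed

text \<open>The map is decreasing, so with \<open>b\<close> its value at 0, the difference
  \<open>t - prox_step x d lam t\<close> changes sign on \<open>{0..b}\<close>.\<close>

lemma prox_step_fixed_point_exists:
  assumes lam: "0 < lam"
  shows "\<exists>t\<ge>0. t = prox_step x d lam t"
proof -
  define b where "b = prox_step x d lam 0"
  have b: "0 \<le> b"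
    by (simp add: b_def prox_step_nonneg)
  have "\<exists>t. 0 \<le> t \<and> t \<le> b \<and> t - prox_step x d lam t = 0"
  proof (rule IVT')
    show "0 - prox_step x d lam 0 \<le> 0"
      by (simp add: prox_step_nonneg)
    show "0 \<le> b - prox_step x d lam b"
      using prox_step_antimono[OF lam order_refl b, of x d] by (simp add: b_def)
    show "continuous_on {0..b} (\<lambda>t. t - prox_step x d lam t)"
      unfolding prox_step_def pos_part_def using lam
      by (intro continuous_intros) (auto simp: add_nonneg_eq_0_iff)
  qed (fact b)
  then show ?thesis
    by auto
qed

lemma prox_step_fixed_point_is_arg_min:
  assumes lam: "0 < lam" and t: "0 \<le> t" "t = prox_step x d lam t"
  shows "is_arg_min (coord_objective x d lam) (\<lambda>s. 0 \<le> s) s \<longleftrightarrow> s = t"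
proof -
  let ?f = "coord_objective x d lam"
  have growth: "?f t + 1/2 * (s - t)\<^sup>2 \<le> ?f s" if s: "0 \<le> s" for s
  proof -
    \<comment> \<open>The slope of \<open>lam * x\<^sup>2 / (s + lam)\<close> at
      \<open>s = t\<close> is \<open>- g\<close>. The quadratic part is handled by the projection
      inequality, the convex fraction by its tangent at \<open>t\<close>.\<close>
    define g where "g = lam * x\<^sup>2 / (t + lam)\<^sup>2"
    have "1/2 * (t - d)\<^sup>2 - g * t + 1/2 * (s - t)\<^sup>2 \<le> 1/2 * (s - d)\<^sup>2 - g * s"
      using t by (intro pos_part_projection s) (simp add: prox_step_def g_def)
    \<comment> \<open>The gap between the fraction and its tangent, in closed form, so that its sign
      is visible.\<close>
    moreover have "lam * x\<^sup>2 / (s + lam) - lam * x\<^sup>2 / (t + lam) + g * (s - t)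
        = lam * x\<^sup>2 * (s - t)\<^sup>2 / ((t + lam)\<^sup>2 * (s + lam))"
      using lam s t(1) by (simp add: g_def divide_simps add_nonneg_eq_0_iff)
        (simp add: power2_eq_square algebra_simps)
    moreover have "0 \<le> lam * x\<^sup>2 * (s - t)\<^sup>2 / ((t + lam)\<^sup>2 * (s + lam))"
      using lam s by simp
    ultimately show ?thesis
      by (simp add: coord_objective_def algebra_simps)
  qed
  have "?f t \<le> ?f s" if "0 \<le> s" for s
    using growth[OF that] zero_le_power2[of "s - t"] by linarith
  moreover have "s = t" if "0 \<le> s" "?f s \<le> ?f t"
  proof -
    have "(s - t)\<^sup>2 \<le> 0"
      using growth[OF that(1)] that(2) by linarith
    then show ?thesis
      by simp
  qed
  ultimately show ?thesis
    using t(1) by (auto simp: is_arg_min_linorder)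
qed

context
  fixes x d lam :: real
  assumes lam: "0 < lam"
begin

text \<open>The fixed point is the only minimizer, so the choice inside \<open>arg_min\<close> is
  forced to pick it.\<close>

lemma scalar_argmin_unique:
  "is_arg_min (coord_objective x d lam) (\<lambda>s. 0 \<le> s) s \<longleftrightarrow> s = scalar_argmin x d lam"
  and scalar_argmin_nonneg: "0 \<le> scalar_argmin x d lam"
  and scalar_argmin_fixed_point: "scalar_argmin x d lam = prox_step x d lam (scalar_argmin x d lam)"
proof -
  obtain t where t: "0 \<le> t" "t = prox_step x d lam t"
    using prox_step_fixed_point_exists[OF lam] by blast
  note is_arg_min = prox_step_fixed_point_is_arg_min[OF lam t]
  have "scalar_argmin x d lam = t"
    unfolding scalar_argmin_def arg_min_def is_arg_min by simp
  with t is_arg_min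
  show "is_arg_min (coord_objective x d lam) (\<lambda>s. 0 \<le> s) s \<longleftrightarrow> s = scalar_argmin x d lam"
    and "0 \<le> scalar_argmin x d lam"
    and "scalar_argmin x d lam = prox_step x d lam (scalar_argmin x d lam)"
    by simp_all
qed

text \<open>For a decreasing map, a point that lies above its image lies above the fixed point. This
  and the dual lemma turn test points into the bounds behind the limits at 0.\<close>

lemma scalar_argmin_le:
  assumes "0 \<le> c" "prox_step x d lam c \<le> c"
  shows "scalar_argmin x d lam \<le> c"
proof (rule ccontr)
  assume "\<not> scalar_argmin x d lam \<le> c"
  then show False
    using prox_step_antimono[OF lam assms(1), of "scalar_argmin x d lam" x d] assms
      scalar_argmin_fixed_point by linarith
qed

lemma scalar_argmin_ge:
  assumes "0 \<le> c" "c \<le> prox_step x d lam c"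
  shows "c \<le> scalar_argmin x d lam"
proof (rule ccontr)
  assume "\<not> c \<le> scalar_argmin x d lam"
  then show False
    using prox_step_antimono[OF lam scalar_argmin_nonneg, of c x d] assms
      scalar_argmin_fixed_point by linarith
qed

lemma scalar_argmin_eqI:
  assumes "0 \<le> c" "c = prox_step x d lam c"
  shows "scalar_argmin x d lam = c"
  using scalar_argmin_le scalar_argmin_ge assms by (metis order_antisym order_refl)

lemma scalar_argmin_eq_0_iff:
  "scalar_argmin x d lam = 0 \<longleftrightarrow> d + x\<^sup>2 / lam \<le> 0"
proof -
  have "prox_step x d lam 0 = pos_part (d + x\<^sup>2 / lam)"
    using lam by (simp add: prox_step_def power2_eq_square)
  then have "d + x\<^sup>2 / lam \<le> 0 \<longleftrightarrow> 0 = prox_step x d lam 0"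
    by (auto simp: pos_part_def)
  then show ?thesis
    using scalar_argmin_eqI[of 0] scalar_argmin_fixed_point by auto
qed

text \<open>At a positive point the positive part in the fixed point equation is inactive; clearing
  the denominator gives the cubic.\<close>

lemma scalar_argmin_cubic_iff:
  assumes s: "0 < s"
  shows "(s - d) * (s + lam)\<^sup>2 = lam * x\<^sup>2 \<longleftrightarrow> s = scalar_argmin x d lam"
proof -
  have "(s - d) * (s + lam)\<^sup>2 = lam * x\<^sup>2 \<longleftrightarrow> s - d = lam * x\<^sup>2 / (s + lam)\<^sup>2"
    using lam s by (simp add: eq_divide_eq)
  also have "\<dots> \<longleftrightarrow> s = prox_step x d lam s"
    using s by (auto simp: prox_step_def pos_part_def max_def)
  also have "\<dots> \<longleftrightarrow> s = scalar_argmin x d lam"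
    using scalar_argmin_eqI[of s] scalar_argmin_fixed_point s by auto
  finally show ?thesis .
qed

end

text \<open>The fixed point of a decreasing map lies between any point and its image. Applied to the
  minimizer for \<open>lam\<close> and the map for \<open>mu\<close>, this reduces continuity of the
  minimizer to continuity of \<open>prox_step\<close> in the parameter.\<close>

lemma scalar_argmin_dist_le:
  assumes lam: "0 < lam" and mu: "0 < mu"
  shows "\<bar>scalar_argmin x d mu - scalar_argmin x d lam\<bar>
    \<le> \<bar>prox_step x d mu (scalar_argmin x d lam) - scalar_argmin x d lam\<bar>"
proof (cases "scalar_argmin x d mu \<le> scalar_argmin x d lam")
  case True
  then show ?thesis
    using prox_step_antimono[OF mu scalar_argmin_nonneg[OF mu], of x d "scalar_argmin x d lam" x d]
      scalar_argmin_fixed_point[OF mu, of x d] by linarith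
next
  case False
  then show ?thesis
    using prox_step_antimono[OF mu scalar_argmin_nonneg[OF lam], of x d "scalar_argmin x d mu" x d]
      scalar_argmin_fixed_point[OF mu, of x d] by linarith
qed

lemma continuous_on_scalar_argmin: "continuous_on {0<..} (scalar_argmin x d)"
proof (rule continuous_at_imp_continuous_on, rule ballI)
  fix lam :: real
  assume "lam \<in> {0<..}"
  then have lam: "0 < lam"
    by simp
  let ?t = "scalar_argmin x d lam"
  have "?t + lam \<noteq> 0"
    using scalar_argmin_nonneg[OF lam, of x d] lam by simp
  then have "isCont (\<lambda>mu. prox_step x d mu ?t) lam"
    unfolding prox_step_def pos_part_def by (intro continuous_intros) auto
  then have "(\<lambda>mu. prox_step x d mu ?t) \<midarrow>lam\<rightarrow> ?t"
    using scalar_argmin_fixed_point[OF lam, of x d] by (simp add: isCont_def)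
  then have "(\<lambda>mu. \<bar>prox_step x d mu ?t - ?t\<bar>) \<midarrow>lam\<rightarrow> 0"
    by (intro tendsto_rabs_zero) (simp add: LIM_zero)
  moreover have "\<forall>\<^sub>F mu in at lam. norm (scalar_argmin x d mu - ?t) \<le> \<bar>prox_step x d mu ?t - ?t\<bar>"
    using order_tendstoD(1)[OF tendsto_ident_at lam]
    by eventually_elim (simp add: scalar_argmin_dist_le[OF lam])
  ultimately have "(\<lambda>mu. scalar_argmin x d mu - ?t) \<midarrow>lam\<rightarrow> 0"
    by (rule Lim_null_comparison[rotated])
  then show "isCont (scalar_argmin x d) lam"
    by (simp add: isCont_def LIM_zero_iff)
qed

section \<open>The summands of the scalar equation and their limits at 0\<close>

text \<open>For a positive minimizer this is the square of the candidate entry of \<open>x\<close>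
  divided by that of \<open>d\<close>, a summand of the Schur complement; the form chosen stays
  valid when the minimizer is 0.\<close>

definition constraint_term :: "real \<Rightarrow> real \<Rightarrow> real \<Rightarrow> real" where
  "constraint_term x d lam = x\<^sup>2 * scalar_argmin x d lam / (scalar_argmin x d lam + lam)\<^sup>2"

lemma constraint_term_nonneg: "0 < lam \<Longrightarrow> 0 \<le> constraint_term x d lam"
  by (simp add: constraint_term_def scalar_argmin_nonneg)

lemma constraint_term_le:
  assumes lam: "0 < lam"
  shows "constraint_term x d lam \<le> x\<^sup>2 / lam"
proof -
  let ?t = "scalar_argmin x d lam"
  have t: "0 \<le> ?t"
    by (rule scalar_argmin_nonneg[OF lam])
  then have "?t * lam \<le> (?t + lam)\<^sup>2"
    using lam by (simp add: power2_eq_square algebra_simps)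
  then have "?t / (?t + lam)\<^sup>2 \<le> 1 / lam"
    using lam t by (simp add: divide_simps)
  from mult_left_mono[OF this, of "x\<^sup>2"] show ?thesis
    by (simp add: constraint_term_def)
qed

lemma continuous_on_constraint_term: "continuous_on {0<..} (constraint_term x d)"
proof -
  have "scalar_argmin x d lam + lam \<noteq> 0" if "0 < lam" for lam
    using scalar_argmin_nonneg[OF that, of x d] that by linarith
  then show ?thesis
    unfolding constraint_term_def
    by (intro continuous_intros continuous_on_scalar_argmin) auto
qed

text \<open>For \<open>0 < d\<close> the minimizer is squeezed between \<open>d\<close> and
  \<open>d + lam * x\<^sup>2 / d\<^sup>2\<close>.\<close>

lemma tendsto_constraint_term_at_right_0:
  assumes "x = 0 \<or> 0 < d"
  shows "(constraint_term x d \<longlongrightarrow> x\<^sup>2 / pos_part d) (at_right 0)"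
proof (cases "x = 0")
  case True
  then have "constraint_term x d = (\<lambda>_. 0)"
    by (simp add: constraint_term_def fun_eq_iff)
  with True show ?thesis
    by simp
next
  case False
  with assms have d: "0 < d"
    by simp
  have lower: "\<forall>\<^sub>F lam in at_right 0. d \<le> scalar_argmin x d lam"
    using eventually_at_right_less[of 0]
  proof eventually_elim
    case (elim lam)
    then show ?case
      using d by (intro scalar_argmin_ge) (auto simp: prox_step_def pos_part_def)
  qed
  have upper: "\<forall>\<^sub>F lam in at_right 0. scalar_argmin x d lam \<le> d + lam * x\<^sup>2 / d\<^sup>2"
    using eventually_at_right_less[of 0]
  proof eventually_elim
    case (elim lam)
    have "lam * x\<^sup>2 / (d + lam * x\<^sup>2 / d\<^sup>2 + lam)\<^sup>2 \<le> lam * x\<^sup>2 / d\<^sup>2"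
      using elim d by (intro divide_left_mono power_mono mult_pos_pos zero_less_power)
        (auto intro!: add_pos_nonneg)
    then show ?case
      using elim d by (intro scalar_argmin_le) (auto simp: prox_step_def pos_part_def)
  qed
  have "((\<lambda>lam. d + lam * x\<^sup>2 / d\<^sup>2) \<longlongrightarrow> d + 0 * x\<^sup>2 / d\<^sup>2) (at_right 0)"
    using d by (intro tendsto_intros) auto
  then have "((\<lambda>lam. d + lam * x\<^sup>2 / d\<^sup>2) \<longlongrightarrow> d) (at_right 0)"
    by simp
  from tendsto_sandwich[OF lower upper tendsto_const this]
  have lim: "(scalar_argmin x d \<longlongrightarrow> d) (at_right 0)" .
  have "((\<lambda>lam. x\<^sup>2 * scalar_argmin x d lam / (scalar_argmin x d lam + lam)\<^sup>2)
      \<longlongrightarrow> x\<^sup>2 * d / (d + 0)\<^sup>2) (at_right 0)"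
    by (intro tendsto_intros lim) (use d in simp)
  then have "(constraint_term x d \<longlongrightarrow> x\<^sup>2 * d / (d + 0)\<^sup>2) (at_right 0)"
    by (simp add: constraint_term_def[abs_def])
  then show ?thesis
    using d by (simp add: pos_part_def power2_eq_square)
qed

text \<open>Once the minimizer \<open>t\<close> satisfies \<open>lam \<le> t\<close> and
  \<open>t \<le> c\<close>, the term is at least \<open>x\<^sup>2 / (4 * t)\<close>, hence at least
  \<open>x\<^sup>2 / (4 * c)\<close>.\<close>

lemma filterlim_constraint_term_at_right_0:
  assumes x: "x \<noteq> 0" and d: "d \<le> 0"
  shows "filterlim (constraint_term x d) at_top (at_right 0)"
  unfolding filterlim_at_top_gt[where c = 0]
proof (intro allI impI)
  fix M :: real
  assume M: "0 < M"
  \<comment> \<open>Chosen so that \<open>x\<^sup>2 / (4 * c) = M\<close>.\<close>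
  define c where "c = x\<^sup>2 / (4 * M)"
  have c: "0 < c"
    using M x by (simp add: c_def)
  \<comment> \<open>This smallness makes \<open>lam\<close> a lower test point: it lies below
    \<open>d + x\<^sup>2 / (4 * lam)\<close>.\<close>
  have "((\<lambda>lam. lam * (lam - d)) \<longlongrightarrow> 0 * (0 - d)) (at_right 0)"
    by (intro tendsto_intros)
  then have "\<forall>\<^sub>F lam in at_right 0. lam * (lam - d) < x\<^sup>2 / 4"
    using x by (intro order_tendstoD(2)) auto
  \<comment> \<open>This one makes \<open>c\<close> an upper test point, as
    \<open>c ^ 3 \<le> c * (c + lam)\<^sup>2\<close>.\<close>
  moreover have "((\<lambda>lam. lam * x\<^sup>2) \<longlongrightarrow> 0 * x\<^sup>2) (at_right 0)"
    by (intro tendsto_intros)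
  then have "\<forall>\<^sub>F lam in at_right 0. lam * x\<^sup>2 < c ^ 3"
    using c by (intro order_tendstoD(2)) auto
  ultimately show "\<forall>\<^sub>F lam in at_right 0. M \<le> constraint_term x d lam"
    using eventually_at_right_less[of 0]
  proof eventually_elim
    case (elim lam)
    let ?t = "scalar_argmin x d lam"
    have "lam \<le> d + lam * x\<^sup>2 / (lam + lam)\<^sup>2"
      using elim by (simp add: power2_eq_square field_simps)
    then have lam_le: "lam \<le> ?t"
      using elim by (intro scalar_argmin_ge) (auto simp: prox_step_def pos_part_def)
    have "lam * x\<^sup>2 \<le> c * (c + lam)\<^sup>2"
    proof -
      have "c * c\<^sup>2 \<le> c * (c + lam)\<^sup>2"
        using c elim by (intro mult_left_mono power_mono) auto
      then show ?thesis
        using elim by (simp add: power2_eq_square power3_eq_cube)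
    qed
    then have "lam * x\<^sup>2 / (c + lam)\<^sup>2 \<le> c"
      using c elim by (simp add: pos_divide_le_eq)
    then have t_le: "?t \<le> c"
      using c d elim by (intro scalar_argmin_le) (auto simp: prox_step_def pos_part_def)
    have t: "0 < ?t"
      using lam_le elim by linarith
    have "M * (?t + lam)\<^sup>2 \<le> M * (2 * ?t)\<^sup>2"
      using M lam_le elim t by (intro mult_left_mono power_mono) auto
    also have "\<dots> = 4 * M * ?t * ?t"
      by (simp add: power2_eq_square)
    also have "\<dots> \<le> 4 * M * c * ?t"
      using M t t_le by (intro mult_right_mono mult_left_mono) auto
    also have "\<dots> = x\<^sup>2 * ?t"
      using M by (simp add: c_def)
    finally show ?case
      using t elim by (simp add: constraint_term_def pos_le_divide_eq)
  qed
qed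

section \<open>Solvability of the scalar equation\<close>

text \<open>No quotient is infinite: a zero denominator comes with a zero numerator, and
  \<open>0 / 0 = 0\<close> in both \<open>real\<close> and \<open>ereal\<close>.\<close>

lemma ratio_sum_eq_ereal:
  assumes "\<And>i. xbar $ i = 0 \<or> 0 < dbar $ i"
  shows "ratio_sum xbar dbar = ereal (\<Sum>i\<in>UNIV. (xbar $ i)\<^sup>2 / pos_part (dbar $ i))"
proof -
  have "ereal ((xbar $ i)\<^sup>2) / ereal (pos_part (dbar $ i)) = ereal ((xbar $ i)\<^sup>2 / pos_part (dbar $ i))" for i
    using assms[of i] by (cases "0 < dbar $ i") (auto simp: pos_part_def zero_ereal_def[symmetric])
  then show ?thesis
    by (simp add: ratio_sum_def)
qed

lemma ratio_sum_eq_infinity: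
  assumes "xbar $ j \<noteq> 0" "dbar $ j \<le> 0"
  shows "ratio_sum xbar dbar = \<infinity>"
proof -
  have "ereal ((xbar $ j)\<^sup>2) / ereal (pos_part (dbar $ j)) = \<infinity>"
    using assms by (simp add: pos_part_def ereal_quotient_by_zero)
  then show ?thesis
    unfolding ratio_sum_def by (subst sum_Pinfty) (auto simp: exI[of _ j])
qed

text \<open>If every quotient is finite, both sides converge and some \<open>m\<close> separates the
  limits. Otherwise a single summand diverges, the others are nonnegative, and the other side stays
  bounded.\<close>

lemma constraint_sum_eventually_greater:
  assumes "ereal (real k * pos_part abar) < ratio_sum xbar dbar"
  shows "\<forall>\<^sub>F lam in at_right 0. real k * pos_part (abar + real k * lam)
    < (\<Sum>i\<in>UNIV. constraint_term (xbar $ i) (dbar $ i) lam)"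
proof -
  have "((\<lambda>lam. real k * pos_part (abar + real k * lam)) \<longlongrightarrow> real k * pos_part (abar + real k * 0)) (at_right 0)"
    unfolding pos_part_def by (intro tendsto_intros)
  then have rhs: "((\<lambda>lam. real k * pos_part (abar + real k * lam)) \<longlongrightarrow> real k * pos_part abar) (at_right 0)"
    by simp
  show ?thesis
  proof (cases "\<forall>i. xbar $ i = 0 \<or> 0 < dbar $ i")
    case True
    let ?r = "\<Sum>i\<in>UNIV. (xbar $ i)\<^sup>2 / pos_part (dbar $ i)"
    have lhs: "((\<lambda>lam. \<Sum>i\<in>UNIV. constraint_term (xbar $ i) (dbar $ i) lam) \<longlongrightarrow> ?r) (at_right 0)"
      using True by (intro tendsto_sum tendsto_constraint_term_at_right_0) auto
    have "real k * pos_part abar < ?r"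
      using assms True by (simp add: ratio_sum_eq_ereal)
    then obtain m where "real k * pos_part abar < m" "m < ?r"
      using dense by blast
    then show ?thesis
      using order_tendstoD(2)[OF rhs, of m] order_tendstoD(1)[OF lhs, of m]
      by (auto elim: eventually_elim2)
  next
    case False
    then obtain j where j: "xbar $ j \<noteq> 0" "dbar $ j \<le> 0"
      by (auto simp: not_less)
    define m where "m = real k * pos_part abar + 1"
    have "\<forall>\<^sub>F lam in at_right 0. m \<le> constraint_term (xbar $ j) (dbar $ j) lam"
      using filterlim_constraint_term_at_right_0[OF j] by (simp add: filterlim_at_top)
    moreover have "\<forall>\<^sub>F lam in at_right 0. real k * pos_part (abar + real k * lam) < m"
      using order_tendstoD(2)[OF rhs, of m] by (simp add: m_def)
    ultimately show ?thesis
      using eventually_at_right_less[of 0]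
    proof eventually_elim
      case (elim lam)
      have "constraint_term (xbar $ j) (dbar $ j) lam
          \<le> (\<Sum>i\<in>UNIV. constraint_term (xbar $ i) (dbar $ i) lam)"
        using elim by (intro member_le_sum) (auto simp: constraint_term_nonneg)
      with elim show ?case
        by linarith
    qed
  qed
qed

lemma multiplier_equation_solvable:
  assumes k: "0 < k" and gt: "ereal (real k * pos_part abar) < ratio_sum xbar dbar"
  shows "\<exists>lam>0. (\<Sum>i\<in>UNIV. constraint_term (xbar $ i) (dbar $ i) lam)
    = real k * pos_part (abar + real k * lam)"
proof -
  let ?S = "\<lambda>lam. \<Sum>i\<in>UNIV. constraint_term (xbar $ i) (dbar $ i) lam"
  let ?R = "\<lambda>lam. real k * pos_part (abar + real k * lam)"
  have "\<forall>\<^sub>F lam in at_right 0. 0 < lam \<and> lam < 1 \<and> ?R lam < ?S lam"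
    using constraint_sum_eventually_greater[OF gt] eventually_at_right_less[of 0]
      eventually_at_right_real[of 0 1]
    by (auto elim: eventually_elim2 simp: eventually_conj_iff)
  then obtain l where l: "0 < l" "l < 1" "?R l < ?S l"
    using eventually_happens'[of "at_right (0::real)"] by force
  define X where "X = (\<Sum>i\<in>UNIV. (xbar $ i)\<^sup>2)"
  \<comment> \<open>From \<open>1 \<le> u\<close> the left-hand side at \<open>u\<close> is at most
    \<open>X\<close>, and also \<open>l \<le> u\<close>. From
    \<open>X + \<bar>abar\<bar> \<le> u\<close> and \<open>1 \<le> k\<close> the right-hand side is
    at least \<open>X\<close>.\<close>
  define u where "u = max 1 (X + \<bar>abar\<bar>)"
  have X: "0 \<le> X"
    by (simp add: X_def sum_nonneg)
  have u: "1 \<le> u" "X + \<bar>abar\<bar> \<le> u"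
    by (simp_all add: u_def)
  have "?S u \<le> ?R u"
  proof -
    have "?S u \<le> (\<Sum>i\<in>UNIV. (xbar $ i)\<^sup>2 / u)"
      using u by (intro sum_mono constraint_term_le) auto
    also have "\<dots> = X / u"
      by (simp add: X_def sum_divide_distrib)
    also have "\<dots> \<le> X"
      using X u by (simp add: divide_le_eq mult_left_mono[of 1 u X, simplified])
    finally have "?S u \<le> X" .
    moreover have "u \<le> real k * u"
      using k u by simp
    then have *: "X \<le> abar + real k * u"
      using u by linarith
    have "1 * (abar + real k * u) \<le> real k * (abar + real k * u)"
      using * X k by (intro mult_right_mono) auto
    then have "X \<le> ?R u"
      using * X by (simp add: pos_part_def)
    ultimately show ?thesis
      by linarith
  qed
  have "\<exists>lam. l \<le> lam \<and> lam \<le> u \<and> ?S lam - ?R lam = 0"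
  proof (rule IVT2')
    show "continuous_on {l..u} (\<lambda>lam. ?S lam - ?R lam)"
      unfolding pos_part_def using l
      by (intro continuous_intros continuous_on_subset[OF continuous_on_constraint_term]) auto
  qed (use l u \<open>?S u \<le> ?R u\<close> in auto)
  then show ?thesis
    using l by (metis eq_iff_diff_eq_0 less_le_trans)
qed

section \<open>The two cases of the optimal point\<close>

lemma coord_argmin_eq: "coord_argmin xbar dbar lam i = scalar_argmin (xbar $ i) (dbar $ i) lam"
  by (simp add: coord_argmin_def scalar_argmin_def)

lemma projection_optimal:
  assumes k: "0 < k" and le: "ratio_sum xbar dbar \<le> ereal (real k * pos_part abar)"
  shows "optimal k abar xbar dbar z \<longleftrightarrow> z = (pos_part abar, xbar, pos_part_vec dbar)"
\<comment> \<open>With a zero multiplier the Lagrangian is the objective itself, so feasibility of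
  its minimizer is all that remains.\<close>
proof (rule certificate_optimal[where lam = 0 and w = 0])
  have nz: "xbar $ i = 0 \<or> 0 < dbar $ i" for i
    using ratio_sum_eq_infinity[of xbar i dbar] le by (fastforce simp: not_less)
  \<comment> \<open>Unrelated to the zero vector of the certificate: this \<open>w\<close> only
    witnesses feasibility. Where the denominator is 0 so is \<open>xbar $ i\<close>, and
    \<open>w $ i = 0\<close>.\<close>
  define w where "w = (\<chi> i. xbar $ i / pos_part (dbar $ i))"
  show "feasible k (pos_part abar, xbar, pos_part_vec dbar)"
    unfolding feasible_def prod.case
  proof (rule psd_bordered_diagI[where w = w])
    show "0 \<le> pos_part_vec dbar $ i" for i
      by (simp add: pos_part_vec_def pos_part_def)
    show xw: "xbar $ i = pos_part_vec dbar $ i * w $ i" for i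
      using nz[of i] by (auto simp: w_def pos_part_vec_def pos_part_def)
    have "pos_part_vec dbar $ i * (w $ i)\<^sup>2 = (xbar $ i)\<^sup>2 / pos_part (dbar $ i)" for i
      using nz[of i] by (auto simp: w_def pos_part_vec_def pos_part_def power2_eq_square)
    then show "(\<Sum>i\<in>UNIV. pos_part_vec dbar $ i * (w $ i)\<^sup>2) \<le> real k * pos_part abar"
      using le by (simp add: ratio_sum_eq_ereal[OF nz])
  qed
qed (use k in \<open>simp_all add: pos_part_vec_def\<close>)

lemma multiplier_optimal:
  assumes k: "0 < k" and mult: "is_multiplier k abar xbar dbar (a, x, d) lam"
    and eq: "(\<Sum>i\<in>UNIV. constraint_term (xbar $ i) (dbar $ i) lam) = real k * a"
  shows "optimal k abar xbar dbar z \<longleftrightarrow> z = (a, x, d)"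
proof -
  have lam: "0 < lam" and a: "a = pos_part (abar + real k * lam)"
    and d: "d $ i = scalar_argmin (xbar $ i) (dbar $ i) lam"
    and x: "x $ i = d $ i / (d $ i + lam) * xbar $ i" for i
    using mult by (auto simp: is_multiplier_def coord_argmin_eq)
  \<comment> \<open>One vector in two roles: \<open>x = d * w\<close> entrywise gives feasibility,
    and \<open>xbar - x = lam * w\<close> gives stationarity in \<open>x\<close>.\<close>
  define w where "w = (\<chi> i. xbar $ i / (d $ i + lam))"
  have d_nonneg: "0 \<le> d $ i" for i
    using scalar_argmin_nonneg[OF lam] by (simp add: d)
  have xw: "x $ i = d $ i * w $ i" for i
    by (simp add: x w_def)
  have xw': "x $ i = xbar $ i - lam * w $ i" for i
    using d_nonneg[of i] lam by (simp add: x w_def field_simps)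
  have dw: "d $ i = pos_part (dbar $ i + lam * (w $ i)\<^sup>2)" for i
    using scalar_argmin_fixed_point[OF lam, of "xbar $ i" "dbar $ i"]
    by (simp add: d[symmetric] prox_step_def w_def power_divide)
  have dww: "(\<Sum>i\<in>UNIV. d $ i * (w $ i)\<^sup>2) = real k * a"
    unfolding eq[symmetric]
    by (intro sum.cong) (simp_all add: constraint_term_def d[symmetric] w_def power_divide)
  have "feasible k (a, x, d)"
    unfolding feasible_def prod.case
    by (rule psd_bordered_diagI[OF d_nonneg xw]) (simp add: dww)
  \<comment> \<open>Complementary slackness then reads
    \<open>real k * a - 2 * (real k * a) + real k * a = 0\<close>.\<close>
  moreover have "(\<Sum>i\<in>UNIV. x $ i * w $ i) = real k * a"
    unfolding dww[symmetric] by (intro sum.cong) (simp_all add: xw power2_eq_square)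
  ultimately show ?thesis
    using lam dww k by (intro certificate_optimal[OF _ a xw' dw]) auto
qed

lemma constraint_sum_eq_0:
  assumes "is_multiplier k abar xbar dbar (a, x, d) lam" "\<And>i. x $ i = 0"
  shows "(\<Sum>i\<in>UNIV. constraint_term (xbar $ i) (dbar $ i) lam) = 0"
proof (rule sum.neutral, rule ballI)
  fix i
  have "0 < lam" and d: "d $ i = scalar_argmin (xbar $ i) (dbar $ i) lam"
    and "d $ i / (d $ i + lam) * xbar $ i = 0"
    using assms by (auto simp: is_multiplier_def coord_argmin_eq)
  then have "d $ i = 0 \<or> xbar $ i = 0"
    using scalar_argmin_nonneg[of lam "xbar $ i" "dbar $ i"] by auto
  then show "constraint_term (xbar $ i) (dbar $ i) lam = 0"
    by (auto simp: constraint_term_def d)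
qed

text \<open>A positive \<open>a\<close> determines the multiplier. For \<open>a = 0\<close> several
  multipliers may give the same point, but the equation for \<open>lam\<close> makes
  \<open>x\<close> vanish, and then the sum vanishes for every multiplier of that point.\<close>

lemma multiplier_satisfies_equation:
  assumes k: "0 < k"
    and mult: "is_multiplier k abar xbar dbar (a, x, d) lam"
    and eq: "(\<Sum>i\<in>UNIV. constraint_term (xbar $ i) (dbar $ i) lam) = real k * a"
    and mult': "is_multiplier k abar xbar dbar (a, x, d) mu"
  shows "(\<Sum>i\<in>UNIV. constraint_term (xbar $ i) (dbar $ i) mu) = real k * a"
proof (cases "a = 0")
  case False
  then have "real k * lam = real k * mu"
    using mult mult' by (auto simp: is_multiplier_def pos_part_def max_def split: if_splits)
  with k eq show ?thesis
    by simp
next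
  case True
  have lam: "0 < lam"
    using mult by (simp add: is_multiplier_def)
  have "x $ i = 0" for i
  proof -
    have "constraint_term (xbar $ i) (dbar $ i) lam = 0"
      using eq True sum_nonneg_eq_0_iff[of UNIV "\<lambda>i. constraint_term (xbar $ i) (dbar $ i) lam"]
        constraint_term_nonneg[OF lam] by simp
    moreover have "x $ i = d $ i / (d $ i + lam) * xbar $ i"
      and d: "d $ i = scalar_argmin (xbar $ i) (dbar $ i) lam"
      using mult by (auto simp: is_multiplier_def coord_argmin_eq)
    ultimately show ?thesis
      by (auto simp: constraint_term_def)
  qed
  with mult' True show ?thesis
    by (simp add: constraint_sum_eq_0)
qed

theorem proposition2:
  fixes k :: nat and abar :: real and xbar dbar :: "real^'n"
  assumes "0 < k" and "k < CARD('n)"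
  shows
    "(\<exists>!z. optimal k abar xbar dbar z) \<and>
     (\<forall>lam i. 0 < lam \<longrightarrow>
        (let f = coord_objective (xbar $ i) (dbar $ i) lam;
             t = coord_argmin xbar dbar lam i
         in (\<forall>s. is_arg_min f (\<lambda>s. 0 \<le> s) s \<longleftrightarrow> s = t) \<and>
            (if dbar $ i + (xbar $ i)\<^sup>2 / lam \<le> 0
             then t = 0
             else 0 < t \<and>
                  (\<forall>s>0. (s - dbar $ i) * (s + lam)\<^sup>2 = lam * (xbar $ i)\<^sup>2 \<longleftrightarrow> s = t)))) \<and>
     (\<forall>astar xstar dstar. optimal k abar xbar dbar (astar, xstar, dstar) \<longrightarrow>
        (if ratio_sum xbar dbar \<le> ereal (real k * pos_part abar)
         then (astar, xstar, dstar) = (pos_part abar, xbar, pos_part_vec dbar)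
         else (\<exists>lam. is_multiplier k abar xbar dbar (astar, xstar, dstar) lam) \<and>
              (\<forall>lam. is_multiplier k abar xbar dbar (astar, xstar, dstar) lam \<longrightarrow>
                 (\<Sum>i\<in>UNIV. (xbar $ i)\<^sup>2 * coord_argmin xbar dbar lam i
                             / (coord_argmin xbar dbar lam i + lam)\<^sup>2)
                 = real k * pos_part (abar + real k * lam))))"
proof (intro conjI)
  \<comment> \<open>Unique existence and the case distinction are proved together, since in either
    case a certificate identifies all optimal points at once.\<close>
  have "(\<exists>!z. optimal k abar xbar dbar z) \<and>
     (\<forall>astar xstar dstar. optimal k abar xbar dbar (astar, xstar, dstar) \<longrightarrow>
        (if ratio_sum xbar dbar \<le> ereal (real k * pos_part abar)
         then (astar, xstar, dstar) = (pos_part abar, xbar, pos_part_vec dbar)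
         else (\<exists>lam. is_multiplier k abar xbar dbar (astar, xstar, dstar) lam) \<and>
              (\<forall>lam. is_multiplier k abar xbar dbar (astar, xstar, dstar) lam \<longrightarrow>
                 (\<Sum>i\<in>UNIV. (xbar $ i)\<^sup>2 * coord_argmin xbar dbar lam i
                             / (coord_argmin xbar dbar lam i + lam)\<^sup>2)
                 = real k * pos_part (abar + real k * lam))))" (is "?unique \<and> ?cases")
  proof (cases "ratio_sum xbar dbar \<le> ereal (real k * pos_part abar)")
    case True
    then show ?thesis
      by (simp add: projection_optimal[OF \<open>0 < k\<close>])
  next
    case False
    then obtain lam where lam: "0 < lam"
      and eq: "(\<Sum>i\<in>UNIV. constraint_term (xbar $ i) (dbar $ i) lam)
        = real k * pos_part (abar + real k * lam)"
      using multiplier_equation_solvable[OF \<open>0 < k\<close>, of abar xbar dbar] by (auto simp: not_le)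
    define a where "a = pos_part (abar + real k * lam)"
    define d where "d = (\<chi> i. coord_argmin xbar dbar lam i)"
    define x where "x = (\<chi> i. d $ i / (d $ i + lam) * xbar $ i)"
    have mult: "is_multiplier k abar xbar dbar (a, x, d) lam"
      using lam by (simp add: is_multiplier_def a_def d_def x_def)
    note eq = eq[folded a_def]
    note opt = multiplier_optimal[OF \<open>0 < k\<close> mult eq]
    have "(\<Sum>i\<in>UNIV. (xbar $ i)\<^sup>2 * coord_argmin xbar dbar mu i / (coord_argmin xbar dbar mu i + mu)\<^sup>2)
        = real k * pos_part (abar + real k * mu)"
      if mult': "is_multiplier k abar xbar dbar (a, x, d) mu" for mu
      using multiplier_satisfies_equation[OF \<open>0 < k\<close> mult eq mult'] mult'
      by (simp add: constraint_term_def coord_argmin_eq is_multiplier_def)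
    then show ?thesis
      using False mult by (auto simp: opt)
  qed
  then show ?unique and ?cases
    by blast+
  show "\<forall>lam i. 0 < lam \<longrightarrow>
        (let f = coord_objective (xbar $ i) (dbar $ i) lam;
             t = coord_argmin xbar dbar lam i
         in (\<forall>s. is_arg_min f (\<lambda>s. 0 \<le> s) s \<longleftrightarrow> s = t) \<and>
            (if dbar $ i + (xbar $ i)\<^sup>2 / lam \<le> 0
             then t = 0
             else 0 < t \<and>
                  (\<forall>s>0. (s - dbar $ i) * (s + lam)\<^sup>2 = lam * (xbar $ i)\<^sup>2 \<longleftrightarrow> s = t)))"
  proof (intro allI impI)
    fix lam :: real and i
    assume lam: "0 < lam"
    have "0 < scalar_argmin (xbar $ i) (dbar $ i) lam"
      if "\<not> dbar $ i + (xbar $ i)\<^sup>2 / lam \<le> 0"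
      using that scalar_argmin_eq_0_iff[OF lam] scalar_argmin_nonneg[OF lam] by (metis order_le_less)
    then show "let f = coord_objective (xbar $ i) (dbar $ i) lam;
             t = coord_argmin xbar dbar lam i
         in (\<forall>s. is_arg_min f (\<lambda>s. 0 \<le> s) s \<longleftrightarrow> s = t) \<and>
            (if dbar $ i + (xbar $ i)\<^sup>2 / lam \<le> 0
             then t = 0
             else 0 < t \<and>
                  (\<forall>s>0. (s - dbar $ i) * (s + lam)\<^sup>2 = lam * (xbar $ i)\<^sup>2 \<longleftrightarrow> s = t))"
      by (simp add: Let_def coord_argmin_eq scalar_argmin_unique[OF lam]
          scalar_argmin_eq_0_iff[OF lam] scalar_argmin_cubic_iff[OF lam])
  qed
qed

end
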